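(* Let $(Z_n(x))_{n\ge1}$ be the polynomials (alternating runs polynomials of type $B$) defined by $Z_1(x)=x$ and $$Z_n(x)=\bigl[(2n-2)x^2+3x-1\bigr]Z_{n-1}(x)+2x(1-x^2)\,\frac{d}{dx}Z_{n-1}(x)\qquad(n\ge 2)$$ (so $Z_2(x)=x+3x^2$). Then the Turán expressions $(Z_{n+1}(x))^2-Z_{n+2}(x)Z_n(x)$ are Hurwitz stable for all $n\ge1$.
   Context: A polynomial $f\in\mathbb{C}[x]$ is Hurwitz stable if it is identically zero or $f(x)\ne0$ whenever $\Re(x)>0$. Combinatorially (not needed for the statement), the coefficient $Z(n,k)$ of $x^k$ in $Z_n(x)$ counts signed permutations $\pi$ of $\{\pm1,\dots,\pm n\}$ with $\pi_1>0$ (and $\pi_0=0$) having $k-1$ indices $i\in\{1,\dots,n-1\}$ with $\pi_{i-1}<\pi_i>\pi_{i+1}$ or $\pi_{i-1}>\pi_i<\pi_{i+1}$, and $Z(n,k)=(2k-1)Z(n-1,k)+3Z(n-1,k-1)+(2n-2k+2)Z(n-1,k-2)$. *)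

theory Defs
  imports "HOL-Computational_Algebra.Polynomial" Complex_Main
begin

definition hurwitz_stable :: "complex poly \<Rightarrow> bool" where
  "hurwitz_stable f \<longleftrightarrow> f = 0 \<or> (\<forall>x. Re x > 0 \<longrightarrow> poly f x \<noteq> 0)"

(* Coefficient lists are in increasing degree: [:-1, 3, 2n-2:] is (2n-2)x^2 + 3x - 1 and
   [:0, 2, 0, -2:] is 2x(1-x^2). The sequence starts at index 1; the value at 0 is a dummy. *)
fun alt_runs_B :: "nat \<Rightarrow> complex poly" where
  "alt_runs_B 0 = 0"
| "alt_runs_B (Suc 0) = [:0, 1:]"
| "alt_runs_B (Suc (Suc m)) =
     [:-1, 3, 2 * of_nat (Suc (Suc m)) - 2:] * alt_runs_B (Suc m)
     + [:0, 2, 0, -2:] * pderiv (alt_runs_B (Suc m))"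

lemma alt_runs_B_rec:
  assumes "n \<ge> 2"
  shows "alt_runs_B n =
    [:-1, 3, 2 * of_nat n - 2:] * alt_runs_B (n - 1) + [:0, 2, 0, -2:] * pderiv (alt_runs_B (n - 1))"
proof -
  obtain m where "n = Suc (Suc m)"
    using assms by (metis add_2_eq_Suc le_Suc_ex)
  then show ?thesis by simp
qed

lemma alt_runs_B_2: "alt_runs_B 2 = [:0, 1, 3:]"
  by (simp add: numeral_2_eq_2 pderiv_pCons)

end

theory Submission
  imports Defs "HOL-Computational_Algebra.Fundamental_Theorem_Algebra"
begin

text \<open>
  Under the substitution \<open>x = 2q / (1 + q\<^sup>2)\<close>, which maps the right half-plane onto itself, \<open>Z\<^sub>n(x)\<close>
  becomes \<open>2q (1 + q)\<^sup>n\<^sup>-\<^sup>2 B\<^sub>n(q) / (1 + q\<^sup>2)\<^sup>n\<close>, where \<open>B\<^sub>n\<close> is the type \<open>B\<close> Eulerian polynomial, so the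
  claim reduces to the Turan expressions of the \<open>B\<^sub>n\<close>. Since
  \<open>B\<^sub>n = \<Prod>(q + s\<^sub>i)\<close> with all \<open>s\<^sub>i > 0\<close>, partial fractions give
  \<open>B\<^sub>n\<^sub>+\<^sub>1\<^sup>2 - B\<^sub>n\<^sub>+\<^sub>2 B\<^sub>n = - 4 q B\<^sub>n\<^sup>2 (n + 1 + (1 - q)\<^sup>2 \<Sum>t\<^sub>i)\<close> with \<open>t\<^sub>i = s\<^sub>i / (q + s\<^sub>i)\<^sup>2\<close>.
  For \<open>q = a + \<i>b\<close> with \<open>a > 0\<close>, \<open>b > 0\<close>, each \<open>t\<^sub>i\<close> satisfies \<open>- Im t\<^sub>i \<ge> 2b \<bar>t\<^sub>i\<bar>\<^sup>2\<close>, that is, it lies in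
  a fixed disk. The mean of the \<open>n\<close> numbers \<open>t\<^sub>i\<close> then lies in that disk as well, whereas
  \<open>- (1 + 1/n) / (1 - q)\<^sup>2\<close> does not.
\<close>

section \<open>Logarithmic derivatives of products of linear factors\<close>

lemma pderiv_mult_linear:
  fixes c :: "'a::field"
  shows "pderiv (p * [:c, 1:]) = p + [:c, 1:] * pderiv p"
  by (subst pderiv_mult) (simp add: pderiv_pCons)

lemma poly_pderiv_prod_linear:
  fixes s :: "nat \<Rightarrow> 'a::field"
  assumes "\<And>i. i < n \<Longrightarrow> q + s i \<noteq> 0"
  shows "poly (pderiv (\<Prod>i<n. [:s i, 1:])) q
           = poly (\<Prod>i<n. [:s i, 1:]) q * (\<Sum>i<n. 1 / (q + s i))"
  using assms
proof (induction n)
  case (Suc n)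
  let ?P = "\<Prod>i<n. [:s i, 1:]"
  have nz: "q + s n \<noteq> 0" using Suc.prems by simp
  have "poly (pderiv (\<Prod>i<Suc n. [:s i, 1:])) q = poly ?P q + (q + s n) * poly (pderiv ?P) q"
    unfolding prod.lessThan_Suc pderiv_mult_linear by (simp add: algebra_simps)
  also have "poly (pderiv ?P) q = poly ?P q * (\<Sum>i<n. 1 / (q + s i))"
    using Suc by simp
  also have "poly ?P q + (q + s n) * \<dots> = poly ?P q * (q + s n) * ((\<Sum>i<n. 1 / (q + s i)) + 1 / (q + s n))"
    using nz by (simp add: distrib_left mult.commute mult.left_commute add.commute)
  finally show ?case by (simp add: algebra_simps)
qed simp

text \<open>This is \<open>P'' / P = (P' / P)^2 + (P' / P)'\<close>, proved by induction on the
  number of factors so that only polynomials are differentiated.\<close>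

lemma poly_pderiv2_prod_linear:
  fixes s :: "nat \<Rightarrow> 'a::field"
  assumes "\<And>i. i < n \<Longrightarrow> q + s i \<noteq> 0"
  shows "poly (pderiv (pderiv (\<Prod>i<n. [:s i, 1:]))) q
           = poly (\<Prod>i<n. [:s i, 1:]) q
             * ((\<Sum>i<n. 1 / (q + s i))\<^sup>2 - (\<Sum>i<n. 1 / (q + s i)\<^sup>2))"
  using assms
proof (induction n)
  case (Suc n)
  let ?P = "\<Prod>i<n. [:s i, 1:]" and ?L = "\<Sum>i<n. 1 / (q + s i)" and ?M = "\<Sum>i<n. 1 / (q + s i)\<^sup>2"
  have nz: "q + s n \<noteq> 0" using Suc.prems by simp
  have 1: "poly (pderiv ?P) q = poly ?P q * ?L"
    using Suc.prems by (intro poly_pderiv_prod_linear) simp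
  have 2: "poly (pderiv (pderiv ?P)) q = poly ?P q * (?L\<^sup>2 - ?M)"
    using Suc by simp
  have "pderiv (pderiv (\<Prod>i<Suc n. [:s i, 1:])) = pderiv (?P + pderiv ?P * [:s n, 1:])"
    unfolding prod.lessThan_Suc pderiv_mult_linear by (simp only: mult.commute)
  also have "\<dots> = pderiv ?P + (pderiv ?P + [:s n, 1:] * pderiv (pderiv ?P))"
    unfolding pderiv_add pderiv_mult_linear ..
  finally have "poly (pderiv (pderiv (\<Prod>i<Suc n. [:s i, 1:]))) q
      = (q + s n) * poly (pderiv (pderiv ?P)) q + 2 * poly (pderiv ?P) q"
    by (simp add: algebra_simps)
  also have "\<dots> = poly ?P q * (q + s n)
      * ((?L + 1 / (q + s n))\<^sup>2 - (?M + 1 / (q + s n)\<^sup>2))"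
    unfolding 1 2 power_one_over[symmetric] using right_inverse[OF nz]
    by (simp only: divide_inverse mult_1) algebra
  finally show ?case by (simp add: algebra_simps)
qed simp

section \<open>Type B Eulerian polynomials and their negative real roots\<close>

primrec eulerian_B :: "nat \<Rightarrow> complex poly" where
  "eulerian_B 0 = 1"
| "eulerian_B (Suc n) =
     [:1, 2 * of_nat n + 1:] * eulerian_B n + [:0, 2, -2:] * pderiv (eulerian_B n)"

lemma poly_eulerian_B_Suc:
  "poly (eulerian_B (Suc n)) q
     = (1 + (2 * of_nat n + 1) * q) * poly (eulerian_B n) q
       + 2 * q * (1 - q) * poly (pderiv (eulerian_B n)) q"
  by (simp add: algebra_simps)

text \<open>In the recurrence the top coefficient is multiplied by
  \<open>(2n + 1) - 2n = 1\<close>.\<close>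

lemma eulerian_B_monic:
  "degree (eulerian_B n) \<le> n \<and> coeff (eulerian_B n) n = 1"
proof (induction n)
  case (Suc n)
  have *: "coeff (eulerian_B (Suc n)) (Suc k)
      = coeff (eulerian_B n) (Suc k) + (2 * of_nat n + 1) * coeff (eulerian_B n) k
        + 2 * of_nat (Suc k) * coeff (eulerian_B n) (Suc k)
        - 2 * of_nat k * coeff (eulerian_B n) k" for k
    by (cases k) (simp_all add: coeff_pderiv algebra_simps)
  have 0: "coeff (eulerian_B n) k = 0" if "k > n" for k
    using Suc that by (meson coeff_eq_0 le_less_trans)
  have "degree (eulerian_B (Suc n)) \<le> Suc n"
  proof (rule degree_le, intro allI impI)
    fix i assume "Suc n < i"
    then obtain k where "i = Suc k" "k > n" by (cases i) auto
    then show "coeff (eulerian_B (Suc n)) i = 0" unfolding \<open>i = Suc k\<close> * by (simp add: 0)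
  qed
  moreover have "coeff (eulerian_B (Suc n)) (Suc n) = 1"
    unfolding * using Suc by (simp add: 0)
  ultimately show ?case by simp
qed simp

text \<open>
  The expression below is the quotient of \<open>B\<^sub>n\<^sub>+\<^sub>1(q)\<close> by \<open>(1 - q) B\<^sub>n(q)\<close>. Its imaginary part has
  the sign of \<open>Im q\<close>, which forces the roots of \<open>B\<^sub>n\<^sub>+\<^sub>1\<close> to be real.
\<close>

lemma eulerian_B_quotient_nonzero:
  fixes s :: "nat \<Rightarrow> real" and q :: complex
  assumes s: "\<And>i. i < n \<Longrightarrow> s i > 0" and "q \<noteq> 1" and q: "Im q \<noteq> 0 \<or> Re q \<ge> 0"
  shows "(2 * of_nat n + 2) / (1 - q) - 1 - 2 * (\<Sum>i<n. of_real (s i) / (q + of_real (s i))) \<noteq> 0"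
    (is "?K \<noteq> 0")
proof (cases "Im q = 0")
  case False
  have ne: "1 - q \<noteq> 0" using assms(2) by simp
  have im: "Im (of_real c / z) = - c * Im z / (norm z)\<^sup>2" for c z
    by (simp add: Im_divide cmod_power2)
  have "?K = of_real (2 * n + 2) / (1 - q) - 1 - of_real 2 * (\<Sum>i<n. of_real (s i) / (q + of_real (s i)))"
    by simp
  also have "Im \<dots> = Im q * ((2 * n + 2) / (norm (1 - q))\<^sup>2
      + 2 * (\<Sum>i<n. s i / (norm (q + of_real (s i)))\<^sup>2))"
    by (simp only: minus_complex.simps Im_complex_of_real Re_complex_of_real times_complex.simps Im_sum im)
       (simp add: sum_distrib_left algebra_simps sum_negf)
  finally have "Im ?K = Im q * ((2 * n + 2) / (norm (1 - q))\<^sup>2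
      + 2 * (\<Sum>i<n. s i / (norm (q + of_real (s i)))\<^sup>2))" .
  moreover have "(2 * n + 2) / (norm (1 - q))\<^sup>2
      + 2 * (\<Sum>i<n. s i / (norm (q + of_real (s i)))\<^sup>2) > 0"
    using ne s by (intro add_pos_nonneg mult_nonneg_nonneg sum_nonneg) (simp_all add: less_imp_le)
  ultimately have "Im ?K \<noteq> 0" using False by (simp only: mult_eq_0_iff less_imp_neq[symmetric]) simp
  then show ?thesis by (rule contrapos_nn) (simp only: zero_complex.sel)
next
  case True
  define x where "x = Re q"
  have qx: "q = of_real x" using True by (simp add: x_def complex_eq_iff)
  have x: "x \<ge> 0" "x \<noteq> 1" using True q assms(2) by (auto simp: x_def complex_eq_iff)
  define S where "S = (\<Sum>i<n. s i / (x + s i))"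
  have "S \<ge> 0" unfolding S_def using s x by (intro sum_nonneg) (simp add: less_imp_le)
  have "S \<le> (\<Sum>i<n. 1)"
    unfolding S_def
  proof (rule sum_mono)
    fix i assume "i \<in> {..<n}"
    then show "s i / (x + s i) \<le> 1" using s[of i] x by (simp add: field_simps)
  qed
  then have "S \<le> n" by simp
  have K: "?K = of_real ((2 * n + 2) / (1 - x) - 1 - 2 * S)" by (simp add: qx S_def)
  \<comment> \<open>Since \<open>0 <= S <= n\<close>, the value is at least \<open>1\<close> for
    \<open>x < 1\<close> and at most \<open>-1\<close> for \<open>x > 1\<close>.\<close>
  have "(2 * n + 2) / (1 - x) - 1 - 2 * S \<noteq> 0"
  proof (cases "x < 1")
    case True
    then have "(2 * n + 2) / (1 - x) \<ge> 2 * n + 2" using x by (simp add: field_simps)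
    then show ?thesis using \<open>S \<le> n\<close> by simp
  next
    case False
    then have "(2 * n + 2) / (1 - x) \<le> 0" using x by (simp add: divide_nonneg_neg divide_nonneg_nonpos)
    then show ?thesis using \<open>S \<ge> 0\<close> by simp
  qed
  then show ?thesis unfolding K by (metis of_real_eq_0_iff)
qed

lemma monic_poly_complex_factorization:
  fixes p :: "complex poly"
  assumes "degree p = n" "lead_coeff p = 1"
    and roots: "\<And>z. poly p z = 0 \<Longrightarrow> Im z = 0 \<and> Re z < 0"
  shows "\<exists>s::nat \<Rightarrow> real. (\<forall>i<n. s i > 0) \<and> p = (\<Prod>i<n. [:of_real (s i), 1:])"
proof -
  have "p \<noteq> 0" using assms(2) by auto
  then obtain A where A: "size A = n" "p = (\<Prod>x\<in>#A. [:-x, 1:])"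
    using alg_closed_imp_factorization[of p] assms by auto
  obtain xs where xs: "A = mset xs" using ex_mset by metis
  have len: "length xs = n" using A xs by simp
  have p: "p = (\<Prod>i<n. [:-(xs ! i), 1:])"
  proof -
    have "p = prod_list (map (\<lambda>x. [:-x, 1:]) xs)"
      unfolding A(2) xs by (metis mset_map prod_mset_prod_list)
    then show ?thesis using len by (simp add: prod.list_conv_set_nth atLeast0LessThan)
  qed
  have r: "Im (xs ! i) = 0 \<and> Re (xs ! i) < 0" if "i < n" for i
  proof (rule roots)
    show "poly p (xs ! i) = 0" unfolding p poly_prod using that by (auto intro!: prod_zero)
  qed
  show ?thesis
  proof (intro exI conjI allI impI)
    fix i assume "i < n" then show "- Re (xs ! i) > 0" using r by simp
  next
    show "p = (\<Prod>i<n. [:of_real (- Re (xs ! i)), 1:])"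
      unfolding p by (intro prod.cong refl) (use r in \<open>simp add: complex_eq_iff\<close>)
  qed
qed

text \<open>Induction: the factorization of \<open>B_n\<close> turns the recurrence into
  \<open>B_(n+1) = (1 - q) B_n K\<close>, where \<open>K\<close> is the quotient shown nonzero
  above. Hence a root of \<open>B_(n+1)\<close> can only be a negative real.\<close>

lemma eulerian_B_negative_roots:
  "\<exists>s::nat \<Rightarrow> real. (\<forall>i<n. s i > 0) \<and> eulerian_B n = (\<Prod>i<n. [:of_real (s i), 1:])"
proof (induction n)
  case (Suc n)
  then obtain s where s: "\<And>i. i < n \<Longrightarrow> s i > (0::real)"
    and B: "eulerian_B n = (\<Prod>i<n. [:of_real (s i), 1:])" by blast
  have deg: "degree (eulerian_B (Suc n)) = Suc n"
    using eulerian_B_monic[of "Suc n"] by (metis le_antisym le_degree zero_neq_one)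
  show ?case
  proof (rule monic_poly_complex_factorization[OF deg])
    show "lead_coeff (eulerian_B (Suc n)) = 1" using deg eulerian_B_monic[of "Suc n"] by metis
  next
    fix q assume root: "poly (eulerian_B (Suc n)) q = 0"
    show "Im q = 0 \<and> Re q < 0"
    proof (rule ccontr)
      assume "\<not> (Im q = 0 \<and> Re q < 0)"
      then have q: "Im q \<noteq> 0 \<or> Re q \<ge> 0" by auto
      have nz: "q + of_real (s i) \<noteq> 0" if "i < n" for i
        using q s[OF that] by (auto simp: complex_eq_iff)
      have P: "poly (eulerian_B n) q \<noteq> 0"
        unfolding B poly_prod using nz by (auto simp: add.commute)
      define S where "S = (\<Sum>i<n. of_real (s i) / (q + of_real (s i)))"
      have "(\<Sum>i<n. q * (1 / (q + of_real (s i)))) = (\<Sum>i<n. 1 - of_real (s i) / (q + of_real (s i)))"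
        by (intro sum.cong refl) (use nz in \<open>simp add: field_simps\<close>)
      then have L: "q * (\<Sum>i<n. 1 / (q + of_real (s i))) = of_nat n - S"
        by (simp add: sum_subtractf S_def sum_distrib_left)
      have d: "poly (pderiv (eulerian_B n)) q = poly (eulerian_B n) q * (\<Sum>i<n. 1 / (q + of_real (s i)))"
        unfolding B by (rule poly_pderiv_prod_linear) (rule nz)
      have E: "poly (eulerian_B (Suc n)) q
          = poly (eulerian_B n) q * (1 + (2 * of_nat n + 1) * q + 2 * (1 - q) * (of_nat n - S))"
        unfolding poly_eulerian_B_Suc d L[symmetric] by (simp add: algebra_simps)
      \<comment> \<open>The factor \<open>1 - q\<close> cannot be split off at \<open>q = 1\<close>;
        there the recurrence reads \<open>B_(n+1)(1) = (2n + 2) B_n(1)\<close>.\<close>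
      have "q \<noteq> 1"
      proof
        assume "q = 1"
        then have "poly (eulerian_B n) q * of_nat (2 * n + 2) = 0"
          using E root by (simp add: algebra_simps)
        then have "of_nat (2 * n + 2) = (0::complex)" using P mult_eq_0_iff by blast
        then show False unfolding of_nat_eq_0_iff by simp
      qed
      have "(1 + (2 * of_nat n + 1) * q + 2 * (1 - q) * (of_nat n - S))
          = (1 - q) * ((2 * of_nat n + 2) / (1 - q) - 1 - 2 * S)"
        using \<open>q \<noteq> 1\<close> by (simp add: field_simps)
      then show False
        using eulerian_B_quotient_nonzero[of n s q] s q \<open>q \<noteq> 1\<close> E P root by (simp add: S_def)
    qed
  qed
qed simp

section \<open>Turan expressions of the Eulerian polynomials\<close>

text \<open>For real \<open>q\<close> the expression is a positive real. Otherwise its vanishing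
  would force the sum of the \<open>t i\<close> to be \<open>-(n + 1) v\<close> with
  \<open>v = 1 / (1 - q)^2\<close>, against the sum of the linearised disk inequalities.\<close>

lemma turan_kernel_nonzero:
  fixes s :: "nat \<Rightarrow> real" and q :: complex
  assumes s: "\<And>i. i < n \<Longrightarrow> s i > 0" and q: "Re q > 0"
  shows "of_nat n + 1 + (1 - q)\<^sup>2 * (\<Sum>i<n. of_real (s i) / (q + of_real (s i))\<^sup>2) \<noteq> 0"
proof (cases "Im q = 0")
  case True
  define x where "x = Re q"
  have qx: "q = of_real x" using True by (simp add: x_def complex_eq_iff)
  have "0 \<le> (1 - x)\<^sup>2 * (\<Sum>i<n. s i / (x + s i)\<^sup>2)"
    using s by (intro mult_nonneg_nonneg sum_nonneg) (simp_all add: less_imp_le)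
  then have "real n + 1 + (1 - x)\<^sup>2 * (\<Sum>i<n. s i / (x + s i)\<^sup>2) \<noteq> 0" by linarith
  moreover have "of_nat n + 1 + (1 - q)\<^sup>2 * (\<Sum>i<n. of_real (s i) / (q + of_real (s i))\<^sup>2)
      = complex_of_real (real n + 1 + (1 - x)\<^sup>2 * (\<Sum>i<n. s i / (x + s i)\<^sup>2))"
    by (simp add: qx)
  ultimately show ?thesis by (metis of_real_eq_0_iff)
next
  case False
  define a b where "a = Re q" and "b = Im q"
  have ab: "a > 0" "b \<noteq> 0" using q False by (simp_all add: a_def b_def)
  define t where "t i = of_real (s i) / (q + of_real (s i))\<^sup>2" for i
  define v where "v = 1 / (1 - q)\<^sup>2"
  have "q \<noteq> 1" using False by auto
  then have vnz: "v \<noteq> 0" "(1 - q)\<^sup>2 * v = 1" by (simp_all add: v_def)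
  define N where "N = (Re v)\<^sup>2 + (Im v)\<^sup>2"
  have N: "N > 0" using vnz by (simp add: N_def complex_eq_iff sum_power2_gt_zero_iff)
  \<comment> \<open>The reciprocals of \<open>v\<close> and \<open>t i\<close> are easy to expand,
    so both imaginary parts are computed from them.\<close>
  have im_recip: "Im z = - Im (1 / z) * ((Re z)\<^sup>2 + (Im z)\<^sup>2)" for z
    by (cases "z = 0") (simp_all add: Im_divide complex_eq_iff sum_power2_eq_zero_iff)
  have inv_v: "Im (1 / v) = - 2 * (1 - a) * b"
    by (simp add: v_def a_def b_def power2_eq_square algebra_simps)
  have Imv: "Im v = 2 * (1 - a) * b * N"
    using im_recip[of v] unfolding inv_v N_def by (simp only: mult_minus_left minus_minus)
  \<comment> \<open>The disk inequality times \<open>b\<close>, linearised in \<open>t\<^sub>i\<close> by means of \<open>\<bar>t\<^sub>i + v\<bar>\<^sup>2 \<ge> 0\<close> so that it can be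
    summed; the factor \<open>b\<close> treats both signs of \<open>b\<close> at once.\<close>
  have tangent: "- b * Im (t i) + 4 * b\<^sup>2 * (Re (t i) * Re v + Im (t i) * Im v) + 2 * b\<^sup>2 * N \<ge> 0"
    if i: "i < n" for i
  proof -
    define M where "M = (Re (t i))\<^sup>2 + (Im (t i))\<^sup>2"
    have si: "s i > 0" using s i by simp
    have "1 / t i = (q + of_real (s i))\<^sup>2 / of_real (s i)" by (simp add: t_def)
    then have "Im (1 / t i) = 2 * b * (a + s i) / s i"
      using si by (simp add: Im_divide_of_real a_def b_def power2_eq_square)
    then have "Im (t i) = - (2 * b * (a + s i) / s i) * M"
      using im_recip[of "t i"] by (simp add: M_def)
    then have "- b * Im (t i) = 2 * b\<^sup>2 * ((a + s i) / s i) * M"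
      by (simp add: power2_eq_square)
    \<comment> \<open>Here \<open>a > 0\<close> enters, through
      \<open>(a + s i) / s i >= 1\<close>.\<close>
    moreover have "2 * b\<^sup>2 * ((a + s i) / s i) * M \<ge> 2 * b\<^sup>2 * 1 * M"
      by (intro mult_right_mono mult_left_mono) (use si ab in \<open>simp_all add: M_def\<close>)
    moreover have "2 * b\<^sup>2 * (M + 2 * (Re (t i) * Re v + Im (t i) * Im v) + N) \<ge> 0"
    proof -
      have "M + 2 * (Re (t i) * Re v + Im (t i) * Im v) + N
          = (Re (t i) + Re v)\<^sup>2 + (Im (t i) + Im v)\<^sup>2"
        by (simp add: M_def N_def power2_eq_square algebra_simps)
      then show ?thesis by simp
    qed
    ultimately show ?thesis by (simp add: algebra_simps)
  qed
  define T where "T = (\<Sum>i<n. t i)"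
  have "0 \<le> (\<Sum>i<n. - b * Im (t i) + 4 * b\<^sup>2 * (Re (t i) * Re v + Im (t i) * Im v) + 2 * b\<^sup>2 * N)"
    by (rule sum_nonneg) (use tangent in simp)
  also have "\<dots> = - b * Im T + 4 * b\<^sup>2 * (Re T * Re v + Im T * Im v) + n * (2 * b\<^sup>2 * N)"
    by (simp only: T_def Re_sum Im_sum sum.distrib sum_constant card_lessThan
        flip: sum_distrib_left sum_distrib_right)
  finally have ge: "0 \<le> - b * Im T + 4 * b\<^sup>2 * (Re T * Re v + Im T * Im v) + n * (2 * b\<^sup>2 * N)" .
  show ?thesis
  proof
    assume "of_nat n + 1 + (1 - q)\<^sup>2 * (\<Sum>i<n. of_real (s i) / (q + of_real (s i))\<^sup>2) = 0"
    then have "(of_nat n + 1 + (1 - q)\<^sup>2 * T) * v = 0" by (simp add: T_def t_def)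
    then have "(of_nat n + 1) * v + T * ((1 - q)\<^sup>2 * v) = 0" by (simp only: algebra_simps)
    then have "T = - (of_nat n + 1) * v"
      unfolding vnz(2) by (simp add: algebra_simps eq_neg_iff_add_eq_0)
    then have ReT: "Re T = - (n + 1) * Re v" and ImT: "Im T = - (n + 1) * Im v" by simp_all
    have "- b * Im T + 4 * b\<^sup>2 * (Re T * Re v + Im T * Im v) + n * (2 * b\<^sup>2 * N)
        = b * (n + 1) * Im v - 4 * b\<^sup>2 * (n + 1) * N + n * (2 * b\<^sup>2 * N)"
      by (simp add: ReT ImT N_def power2_eq_square algebra_simps)
    \<comment> \<open>The factor beside \<open>2 b^2 N\<close> is
      \<open>(n + 1)(1 - a) - 2(n + 1) + n\<close>.\<close>
    also have "\<dots> = - (2 * b\<^sup>2 * N * (1 + (n + 1) * a))"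
      unfolding Imv by (simp add: power2_eq_square algebra_simps)
    also have "\<dots> < 0" using ab N by (simp add: add_pos_pos)
    finally show False using ge by simp
  qed
qed

text \<open>Two uses of the recurrence express everything through \<open>P\<close>, \<open>L\<close>
  and \<open>M\<close>. The \<open>L^2\<close> terms cancel, and \<open>L\<close> and
  \<open>M\<close> survive only in the combination \<open>S = L - q M\<close>.\<close>

lemma eulerian_B_turan_nonzero:
  assumes q: "Re q > 0"
  shows "(poly (eulerian_B (Suc n)) q)\<^sup>2 - poly (eulerian_B (Suc (Suc n))) q * poly (eulerian_B n) q \<noteq> 0"
proof -
  obtain s where s: "\<And>i. i < n \<Longrightarrow> s i > (0::real)"
    and B: "eulerian_B n = (\<Prod>i<n. [:of_real (s i), 1:])"
    using eulerian_B_negative_roots by blast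
  have nz: "q + of_real (s i) \<noteq> 0" if "i < n" for i
    using q s[OF that] by (auto simp: complex_eq_iff)
  define P where "P = poly (eulerian_B n) q"
  define L where "L = (\<Sum>i<n. 1 / (q + of_real (s i)))"
  define M where "M = (\<Sum>i<n. 1 / (q + of_real (s i))\<^sup>2)"
  define S where "S = (\<Sum>i<n. of_real (s i) / (q + of_real (s i))\<^sup>2)"
  have P: "P \<noteq> 0"
    unfolding P_def B poly_prod using nz by (auto simp: add.commute)
  have d1: "poly (pderiv (eulerian_B n)) q = P * L"
    unfolding P_def B L_def by (rule poly_pderiv_prod_linear) (rule nz)
  have d2: "poly (pderiv (pderiv (eulerian_B n))) q = P * (L\<^sup>2 - M)"
    unfolding P_def B L_def M_def by (rule poly_pderiv2_prod_linear) (rule nz)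
  have "(\<Sum>i<n. of_real (s i) / (q + of_real (s i))\<^sup>2)
      = (\<Sum>i<n. 1 / (q + of_real (s i)) - q * (1 / (q + of_real (s i))\<^sup>2))"
  proof (intro sum.cong refl)
    fix i assume "i \<in> {..<n}"
    then have "q + of_real (s i) \<noteq> 0" using nz by simp
    moreover have "of_real (s i) = (q + of_real (s i)) - q" by simp
    ultimately show "of_real (s i) / (q + of_real (s i))\<^sup>2
        = 1 / (q + of_real (s i)) - q * (1 / (q + of_real (s i))\<^sup>2)"
      by (metis (no_types, lifting) diff_divide_distrib mult.right_neutral
          nonzero_divide_mult_cancel_left power2_eq_square times_divide_eq_right)
  qed
  then have S: "S = L - q * M"
    by (simp add: S_def L_def M_def sum_subtractf sum_distrib_left)
  define C where "C = poly (eulerian_B (Suc n)) q"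
  define C' where "C' = poly (pderiv (eulerian_B (Suc n))) q"
  have C: "C = P * (1 + (2 * of_nat n + 1) * q + 2 * q * (1 - q) * L)"
    unfolding C_def poly_eulerian_B_Suc d1 by (simp add: P_def algebra_simps)
  have C': "C' = (2 * of_nat n + 1) * P + (1 + (2 * of_nat n + 1) * q) * (P * L)
      + 2 * (1 - 2 * q) * (P * L) + 2 * q * (1 - q) * (P * (L\<^sup>2 - M))"
    unfolding C'_def
    by (simp add: pderiv_mult pderiv_pCons pderiv_add pderiv_smult pderiv_minus d1 d2 flip: P_def)
       (simp add: algebra_simps)
  have C2: "poly (eulerian_B (Suc (Suc n))) q = (1 + (2 * of_nat n + 3) * q) * C + 2 * q * (1 - q) * C'"
    unfolding poly_eulerian_B_Suc[of "Suc n"] C_def C'_def by (simp add: algebra_simps)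
  have "C\<^sup>2 - poly (eulerian_B (Suc (Suc n))) q * P
      = - 4 * q * P\<^sup>2 * (of_nat n + 1 + (1 - q)\<^sup>2 * S)"
    unfolding C2 C C' S by algebra
  moreover have "of_nat n + 1 + (1 - q)\<^sup>2 * S \<noteq> 0"
    unfolding S_def using turan_kernel_nonzero[OF s q] by simp
  moreover have "q \<noteq> 0" using q by auto
  ultimately show ?thesis using P by (simp del: eulerian_B.simps flip: P_def C_def)
qed

section \<open>The substitution \<open>x = 2q / (1 + q^2)\<close>\<close>

lemma one_plus_square_nonzero:
  fixes q :: complex
  assumes "Re q > 0"
  shows "1 + q\<^sup>2 \<noteq> 0"
proof
  assume "1 + q\<^sup>2 = 0"
  then have "(q - \<i>) * (q + \<i>) = 0" by (simp add: algebra_simps power2_eq_square)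
  then show False using assms by (auto simp: eq_neg_iff_add_eq_0[symmetric])
qed

text \<open>The extra factor \<open>1 + q\<close> on the left avoids a negative exponent at index 1.
  In the induction the identity is differentiated in \<open>q\<close> to express the derivative of
  \<open>Z\<close> through \<open>B\<close> and \<open>B'\<close>.\<close>

lemma alt_runs_B_eq_eulerian_B:
  assumes "Re q > 0"
  shows "poly (alt_runs_B (Suc n)) (2 * q / (1 + q\<^sup>2)) * (1 + q) * (1 + q\<^sup>2) ^ Suc n
           = 2 * q * (1 + q) ^ n * poly (eulerian_B (Suc n)) q"
  using assms
proof (induction n arbitrary: q)
  case 0
  then show ?case using one_plus_square_nonzero[OF 0] by (simp add: field_simps)
next
  case (Suc n)
  define X where "X = (\<lambda>q::complex. 2 * q / (1 + q\<^sup>2))"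
  define Z where "Z = alt_runs_B (Suc n)"
  define B where "B = poly (eulerian_B (Suc n)) q"
  define B' where "B' = poly (pderiv (eulerian_B (Suc n))) q"
  define D where "D = 1 + q\<^sup>2"
  define m where "m = (of_nat n + 1 :: complex)"
  have D: "D \<noteq> 0" using one_plus_square_nonzero[OF Suc.prems] by (simp add: D_def)
  define l where "l = (\<lambda>q. poly Z (X q) * (1 + q) * (1 + q\<^sup>2) ^ Suc n)"
  define r where "r = (\<lambda>q. 2 * q * (1 + q) ^ n * poly (eulerian_B (Suc n)) q)"
  have lr: "l p = r p" if "Re p > 0" for p
    using Suc.IH[OF that] by (simp only: l_def r_def Z_def X_def)
  define a where "a = poly Z (X q)"
  define z' where "z' = poly (pderiv Z) (X q)"
  have dX: "(X has_field_derivative 2 * (1 - q\<^sup>2) / D\<^sup>2) (at q)"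
    unfolding X_def using D
    by (auto intro!: derivative_eq_intros simp: D_def power2_eq_square algebra_simps)
  have dZ: "((\<lambda>q. poly Z (X q)) has_field_derivative z' * (2 * (1 - q\<^sup>2) / D\<^sup>2)) (at q)"
    unfolding z'_def by (rule DERIV_chain2[OF poly_DERIV dX])
  have dl: "(l has_field_derivative z' * (2 * (1 - q\<^sup>2) / D\<^sup>2) * (1 + q) * D ^ Suc n
      + a * D ^ Suc n + a * (1 + q) * (m * D ^ n * (2 * q))) (at q)"
    unfolding l_def a_def
    by (rule derivative_eq_intros dZ refl)+ (simp add: D_def m_def algebra_simps)
  have dr: "(r has_field_derivative 2 * (1 + q) ^ n * B + 2 * q * (of_nat n * (1 + q) ^ (n - 1)) * B
      + 2 * q * (1 + q) ^ n * B') (at q)"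
    unfolding r_def
    by (rule derivative_eq_intros poly_DERIV refl)+ (simp add: B_def B'_def algebra_simps)
  \<comment> \<open>The two sides agree on the open right half-plane, a neighbourhood of
    \<open>q\<close>, so their derivatives at \<open>q\<close> agree.\<close>
  have "(l has_field_derivative 2 * (1 + q) ^ n * B + 2 * q * (of_nat n * (1 + q) ^ (n - 1)) * B
      + 2 * q * (1 + q) ^ n * B') (at q)"
    by (rule DERIV_cong_ev[THEN iffD2, OF refl _ refl dr])
       (use Suc.prems lr in \<open>auto intro!: eventually_nhds_in_open[THEN eventually_mono, of "{z. Re z > 0}"]
           open_Collect_less continuous_intros\<close>)
  note deriv = DERIV_unique[OF dl this]
  define d u where "d = D ^ n" and "u = (1 + q) ^ n"
  \<comment> \<open>With the division by \<open>D\<close> absorbed into \<open>y\<close>, the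
    remaining relations are polynomial.\<close>
  define y where "y = z' * (1 + q) * d / D"
  \<comment> \<open>For \<open>n = 0\<close> the exponent \<open>n - 1\<close> truncates to
    \<open>0\<close>, but both sides vanish.\<close>
  have n1: "of_nat n * (1 + q) ^ (n - 1) * (1 + q) = of_nat n * u"
    by (cases n) (simp_all add: u_def)
  have y: "z' * (2 * (1 - q\<^sup>2) / D\<^sup>2) * (1 + q) * D ^ Suc n = 2 * (1 - q\<^sup>2) * y"
    using D by (simp add: y_def d_def field_simps power2_eq_square)
  have "(2 * (1 - q\<^sup>2) * y + a * D * d + a * (1 + q) * (m * d * (2 * q))) * (1 + q)
      = (2 * u * B + 2 * q * u * B') * (1 + q) + 2 * q * (of_nat n * (1 + q) ^ (n - 1) * (1 + q)) * B"
    using arg_cong[OF deriv, of "\<lambda>z. z * (1 + q)"] unfolding y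
    by (simp add: d_def u_def algebra_simps)
  then have e1: "(2 * (1 - q\<^sup>2) * y + a * D * d + a * (1 + q) * (m * d * (2 * q))) * (1 + q)
      = (2 * u * B + 2 * q * u * B') * (1 + q) + 2 * q * ((m - 1) * u) * B"
    unfolding n1 by (simp add: m_def)
  have e2: "a * (1 + q) * (D * d) = 2 * q * u * B"
    using lr[OF Suc.prems] by (simp add: l_def r_def a_def D_def d_def u_def B_def)
  have "poly (alt_runs_B (Suc (Suc n))) (X q)
      = (2 * m * (X q)\<^sup>2 + 3 * X q - 1) * a + 2 * X q * (1 - (X q)\<^sup>2) * z'"
    by (simp add: a_def z'_def Z_def m_def power2_eq_square algebra_simps)
  also have "\<dots> * (1 + q) * D ^ Suc (Suc n)
      = (8 * m * q\<^sup>2 + 6 * q * D - D\<^sup>2) * a * (1 + q) * d + 4 * q * (D\<^sup>2 - 4 * q\<^sup>2) * y"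
    using D unfolding y_def d_def by (simp add: X_def flip: D_def) (simp add: field_simps power2_eq_square)
  \<comment> \<open>Since \<open>D^2 - 4 q^2 = (1 - q^2)^2\<close>, the multiple
    \<open>2 q (1 - q)\<close> of \<open>e1\<close> eliminates \<open>y\<close>; the coefficient of
    \<open>a\<close> left over is divisible by \<open>D\<close>, so \<open>e2\<close> eliminates
    \<open>a\<close>.\<close>
  also have "\<dots> = 2 * q * ((1 + q) * u) * ((1 + (2 * m + 1) * q) * B + 2 * q * (1 - q) * B')"
    using e1 e2 unfolding D_def by algebra
  also have "\<dots> = 2 * q * (1 + q) ^ Suc n * poly (eulerian_B (Suc (Suc n))) q"
    unfolding poly_eulerian_B_Suc[of "Suc n"] by (simp add: B_def B'_def u_def m_def)
  finally show ?case by (simp only: X_def D_def)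
qed

text \<open>\<open>q\<close> solves \<open>x q^2 - 2 q + x = 0\<close>. As
  \<open>2 / x = q + 1 / q\<close>, the real parts of \<open>q\<close> and \<open>x\<close> have the
  same sign, so either root would do.\<close>

lemma exists_joukowski_preimage:
  fixes x :: complex
  assumes "Re x > 0"
  shows "\<exists>q. Re q > 0 \<and> x = 2 * q / (1 + q\<^sup>2)"
proof -
  have x: "x \<noteq> 0" using assms by auto
  define q where "q = (1 + csqrt (1 - x\<^sup>2)) / x"
  have "(x * q - 1)\<^sup>2 = 1 - x\<^sup>2" using x by (simp add: q_def)
  then have "x * (x * (1 + q\<^sup>2)) = x * (2 * q)" by algebra
  then have eq: "x * (1 + q\<^sup>2) = 2 * q" using x by simp
  then have q: "q \<noteq> 0" using x by auto
  then have nz: "1 + q\<^sup>2 \<noteq> 0" using eq by auto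
  have "2 / x = q + 1 / q"
    using eq x q by (simp add: field_simps power2_eq_square)
  then have "Re (2 / x) = Re q * (1 + 1 / (norm q)\<^sup>2)"
    by (simp add: Re_divide cmod_power2 algebra_simps)
  moreover have "Re (2 / x) > 0" using assms x by (simp add: Re_divide sum_power2_gt_zero_iff)
  ultimately have "Re q * (1 + 1 / (norm q)\<^sup>2) > 0" by simp
  moreover have "1 + 1 / (norm q)\<^sup>2 > 0" by (simp add: add_pos_nonneg)
  ultimately have "Re q > 0" using zero_less_mult_pos2 by blast
  moreover have "x = 2 * q / (1 + q\<^sup>2)" using eq nz by (simp add: field_simps)
  ultimately show ?thesis by blast
qed

theorem proposition3p10:
  fixes n :: nat
  assumes "n \<ge> 1"
  shows "hurwitz_stable ((alt_runs_B (n + 1))\<^sup>2 - alt_runs_B (n + 2) * alt_runs_B n)"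
  unfolding hurwitz_stable_def
proof (intro disjI2 allI impI)
  fix x :: complex
  assume "Re x > 0"
  then obtain q where q: "Re q > 0" and x: "x = 2 * q / (1 + q\<^sup>2)"
    using exists_joukowski_preimage by blast
  obtain m where n: "n = Suc m" using assms by (cases n) auto
  define D where "D = (1 + q\<^sup>2) ^ Suc m"
  define c where "c = 2 * q * (1 + q) ^ m"
  have q1: "q \<noteq> 0" "1 + q \<noteq> 0" using q by (auto simp: complex_eq_iff)
  \<comment> \<open>The factors form geometric progressions in the index, so the square and the
    product in the Turan expression are scaled alike.\<close>
  have e: "poly (alt_runs_B n) x * (1 + q) * D = c * poly (eulerian_B n) q"
    "poly (alt_runs_B (Suc n)) x * (1 + q) * ((1 + q\<^sup>2) * D) = c * (1 + q) * poly (eulerian_B (Suc n)) q"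
    "poly (alt_runs_B (Suc (Suc n))) x * (1 + q) * ((1 + q\<^sup>2)\<^sup>2 * D)
       = c * (1 + q)\<^sup>2 * poly (eulerian_B (Suc (Suc n))) q"
    using alt_runs_B_eq_eulerian_B[OF q, of m] alt_runs_B_eq_eulerian_B[OF q, of "Suc m"]
      alt_runs_B_eq_eulerian_B[OF q, of "Suc (Suc m)"]
    by (simp_all only: n x D_def c_def power_Suc power2_eq_square mult.assoc mult.left_commute mult.commute)
  have "((poly (alt_runs_B (Suc n)) x)\<^sup>2 - poly (alt_runs_B (Suc (Suc n))) x * poly (alt_runs_B n) x)
      * ((1 + q) * ((1 + q\<^sup>2) * D))\<^sup>2
      = (c * (1 + q))\<^sup>2 * ((poly (eulerian_B (Suc n)) q)\<^sup>2
          - poly (eulerian_B (Suc (Suc n))) q * poly (eulerian_B n) q)"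
    using e by algebra
  moreover have "c * (1 + q) \<noteq> 0" using q1 by (simp add: c_def)
  ultimately have "(poly (alt_runs_B (Suc n)) x)\<^sup>2
      - poly (alt_runs_B (Suc (Suc n))) x * poly (alt_runs_B n) x \<noteq> 0"
    using eulerian_B_turan_nonzero[OF q, of n] by force
  then show "poly ((alt_runs_B (n + 1))\<^sup>2 - alt_runs_B (n + 2) * alt_runs_B n) x \<noteq> 0"
    by (simp del: alt_runs_B.simps)
qed

end
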